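(* Let $f:X\to X$ be a homeomorphism of a compact metric space $X$. If $f$ admits an invariant Borel probability measure with full support, then for every $\delta>0$ there exist a compact metric space $Y_\delta$ and a homeomorphism $g_\delta:Y_\delta\to Y_\delta$ such that \[ d_{GH^0}(f,g_\delta)<\delta \qquad\text{and}\qquad h_{\mathrm{top}}(g_\delta)=0 . \]
   Context: A Borel probability measure $\mu$ on $X$ is invariant under $f$ if $\mu(f^{-1}(E))=\mu(E)$ for every Borel set $E\subset X$. Its support is $\mathrm{supp}(\mu)=\{x\in X:\mu(U)>0\text{ for every open neighborhood }U\text{ of }x\}$, and $\mu$ has full support if $\mathrm{supp}(\mu)=X$. Hausdorff distance: for nonempty subsets $A,B$ of a metric space $(X,d)$, $d_H(A,B)=\max\{\sup_{a\in A}\inf_{b\in B}d(a,b),\ \sup_{b\in B}\inf_{a\in A}d(a,b)\}$. $\Delta$-isometry: for compact metric spaces $(X,d^X)$, $(Y,d^Y)$ and $\Delta>0$, a map (not necessarily continuous) $i:X\to Y$ is a $\Delta$-isometry if $\max\{d_H(i(X),Y),\ \sup_{x,x'\in X}|d^Y(i(x),i(x'))-d^X(x,x')|\}<\Delta$. Uniform distance: for (not necessarily continuous) maps $u,v:Z\to W$ between metric spaces, $d_{C^0}(u,v)=\sup_{z\in Z}d^W(u(z),v(z))$. $C^0$-Gromov--Hausdorff distance: for continuous maps $f:X\to X$ and $g:Y\to Y$ of compact metric spaces, $d_{GH^0}(f,g)$ is the infimum of all $\Delta>0$ for which there exist $\Delta$-isometries $i:X\to Y$ and $j:Y\to X$ such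 that $d_{C^0}(g\circ i,i\circ f)<\Delta$ and $d_{C^0}(j\circ g,f\circ j)<\Delta$. Topological entropy: for a continuous map $f:X\to X$ of a compact metric space $(X,d)$, a finite set $E\subset X$ is $(n,\delta)$-separated if $\max_{0\le j\le n-1}d(f^j(x),f^j(y))\ge\delta$ for all distinct $x,y\in E$; $s_n(f,\delta)$ is the supremum of the cardinalities of $(n,\delta)$-separated sets; and $h_{\mathrm{top}}(f)=\lim_{\delta\to0}\limsup_{n\to\infty}\frac1n\log s_n(f,\delta)$. *)

theory Defs
  imports "HOL-Probability.Probability"
begin

text \<open>
  Metric spaces are values of the type \<open>'a metric\<close>, i.e. a carrier \<open>mspace X\<close>
  with a distance \<open>mdist X\<close>; maps between them are HOL functions, relevant only on the
  carrier. Suprema and infima of distances are taken in \<open>ennreal\<close>, where all of them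
  exist, \<open>Sup {} = 0\<close> and \<open>Inf {} = \<infinity>\<close>.

  A compact metric space has at most continuum many points, so up to isometry every such space
  is a value of type \<open>real metric\<close>, whose distance is arbitrary and unrelated to the usual
  one on the reals.
\<close>

definition compact_metric :: "'a metric \<Rightarrow> bool" where
  "compact_metric X \<longleftrightarrow> compact_space (mtopology_of X)"

definition homeomorphism_of :: "'a metric \<Rightarrow> ('a \<Rightarrow> 'a) \<Rightarrow> bool" where
  "homeomorphism_of X f \<longleftrightarrow> homeomorphic_map (mtopology_of X) (mtopology_of X) f"


subsection \<open>Invariant measures\<close>

definition borel_prob_measure :: "'a metric \<Rightarrow> 'a measure \<Rightarrow> bool" where
  "borel_prob_measure X \<mu> \<longleftrightarrow>
     prob_space \<mu> \<and> space \<mu> = mspace X \<and>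
     sets \<mu> = sigma_sets (mspace X) {U. openin (mtopology_of X) U}"

definition invariant_measure :: "'a metric \<Rightarrow> ('a \<Rightarrow> 'a) \<Rightarrow> 'a measure \<Rightarrow> bool" where
  "invariant_measure X f \<mu> \<longleftrightarrow>
     (\<forall>E\<in>sets \<mu>. emeasure \<mu> (f -` E \<inter> mspace X) = emeasure \<mu> E)"

definition measure_support :: "'a metric \<Rightarrow> 'a measure \<Rightarrow> 'a set" where
  "measure_support X \<mu> =
     {x \<in> mspace X. \<forall>U. openin (mtopology_of X) U \<and> x \<in> U \<longrightarrow> emeasure \<mu> U > 0}"

definition full_support :: "'a metric \<Rightarrow> 'a measure \<Rightarrow> bool" where
  "full_support X \<mu> \<longleftrightarrow> measure_support X \<mu> = mspace X"


subsection \<open>The $C^0$-Gromov--Hausdorff distance\<close>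

definition hausdorff_distance :: "'a metric \<Rightarrow> 'a set \<Rightarrow> 'a set \<Rightarrow> ennreal" where
  "hausdorff_distance X A B =
     max (SUP a\<in>A. INF b\<in>B. ennreal (mdist X a b))
         (SUP b\<in>B. INF a\<in>A. ennreal (mdist X a b))"

definition delta_isometry :: "real \<Rightarrow> 'a metric \<Rightarrow> 'b metric \<Rightarrow> ('a \<Rightarrow> 'b) \<Rightarrow> bool" where
  "delta_isometry \<Delta> X Y i \<longleftrightarrow>
     i \<in> mspace X \<rightarrow> mspace Y \<and>
     max (hausdorff_distance Y (i ` mspace X) (mspace Y))
         (SUP x\<in>mspace X. SUP x'\<in>mspace X. ennreal \<bar>mdist Y (i x) (i x') - mdist X x x'\<bar>)
       < ennreal \<Delta>"

definition uniform_distance :: "'a metric \<Rightarrow> 'b metric \<Rightarrow> ('a \<Rightarrow> 'b) \<Rightarrow> ('a \<Rightarrow> 'b) \<Rightarrow> ennreal" where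
  "uniform_distance Z W u v = (SUP z\<in>mspace Z. ennreal (mdist W (u z) (v z)))"

definition GH0_distance ::
  "'a metric \<Rightarrow> ('a \<Rightarrow> 'a) \<Rightarrow> 'b metric \<Rightarrow> ('b \<Rightarrow> 'b) \<Rightarrow> ennreal" where
  "GH0_distance X f Y g =
     Inf {ennreal \<Delta> | \<Delta>. \<Delta> > 0 \<and>
       (\<exists>i j. delta_isometry \<Delta> X Y i \<and> delta_isometry \<Delta> Y X j \<and>
          uniform_distance X Y (g \<circ> i) (i \<circ> f) < ennreal \<Delta> \<and>
          uniform_distance Y X (j \<circ> g) (f \<circ> j) < ennreal \<Delta>)}"


subsection \<open>Topological entropy\<close>

definition separated_set ::
  "'a metric \<Rightarrow> ('a \<Rightarrow> 'a) \<Rightarrow> nat \<Rightarrow> real \<Rightarrow> 'a set \<Rightarrow> bool" where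
  "separated_set X f n \<delta> E \<longleftrightarrow>
     finite E \<and> E \<subseteq> mspace X \<and>
     (\<forall>x\<in>E. \<forall>y\<in>E. x \<noteq> y \<longrightarrow>
        Max ((\<lambda>j. mdist X ((f ^^ j) x) ((f ^^ j) y)) ` {..<n}) \<ge> \<delta>)"

text \<open>
  The supremum is taken in \<open>nat\<close>. For continuous \<open>f\<close>, compact \<open>X\<close>, \<open>n \<ge> 1\<close> and
  \<open>\<delta> > 0\<close> the cardinalities are bounded, so this is the true supremum. The value at
  \<open>n = 0\<close>, where the maximum above is over the empty set, does not affect the limit superior.
  The limit superior is antitone in \<open>\<delta>\<close>, so its limit at \<open>0\<close> exists in \<open>ereal\<close>.
\<close>

definition separation_number :: "'a metric \<Rightarrow> ('a \<Rightarrow> 'a) \<Rightarrow> nat \<Rightarrow> real \<Rightarrow> nat" where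
  "separation_number X f n \<delta> = (SUP E\<in>{E. separated_set X f n \<delta> E}. card E)"

definition topological_entropy :: "'a metric \<Rightarrow> ('a \<Rightarrow> 'a) \<Rightarrow> ereal" where
  "topological_entropy X f =
     Lim (at_right 0)
       (\<lambda>\<delta>. limsup (\<lambda>n. ereal (1 / real n * ln (real (separation_number X f n \<delta>)))))"

end

theory Submission
  imports Defs
begin

text \<open>
  By Poincare recurrence for the invariant measure of full support, every nonempty open set
  contains a point whose orbit returns to it. Closing up such orbit segments, started near the
  points of a finite net, gives finitely many periodic pseudo-orbits that are dense up to a small
  error. Their disjoint union, with the distance of \<open>X\<close> enlarged by a small constant
  off the diagonal so that coinciding points are separated, is a finite metric space, and moving
  along the pseudo-orbits is a permutation of it. A permutation of a finite space is a
  homeomorphism of entropy zero.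
\<close>

section \<open>Recurrence and periodic pseudo-orbits\<close>

text \<open>All iterated preimages of \<open>U\<close> have the measure of \<open>U\<close>. Were
  they pairwise disjoint, their measures would be summable, although constant and positive. A common
  point of the \<open>m\<close>-th and the \<open>n\<close>-th preimage, moved forward
  \<open>m\<close> times, lies in \<open>U\<close> and returns after \<open>n - m\<close>
  steps.\<close>

lemma (in finite_measure) poincare_recurrence:
  assumes f: "f \<in> measurable M M"
    and inv: "\<And>E. E \<in> sets M \<Longrightarrow> emeasure M (f -` E \<inter> space M) = emeasure M E"
    and U: "U \<in> sets M" "emeasure M U > 0"
  obtains x n where "x \<in> U" "n > 0" "(f ^^ n) x \<in> U"
proof -
  define A where "A k = (f ^^ k) -` U \<inter> space M" for k
  have A0: "A 0 = U" using sets.sets_into_space[OF U(1)] by (auto simp: A_def)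
  have ASuc: "A (Suc k) = f -` A k \<inter> space M" for k
    using measurable_space[OF f] by (auto simp: A_def funpow_swap1)
  have A: "A k \<in> sets M \<and> emeasure M (A k) = emeasure M U" for k
  proof (induction k)
    case (Suc k)
    then show ?case using measurable_sets[OF f, of "A k"] inv[of "A k"] by (auto simp: ASuc)
  qed (use A0 U in auto)
  have "\<not> disjoint_family A"
  proof
    assume "disjoint_family A"
    then have "summable (\<lambda>k. measure M (A k))"
      using finite_measure_UNION[of A] A by (auto simp: summable_def)
    then have "(\<lambda>k. measure M (A k)) \<longlonglongrightarrow> 0" by (rule summable_LIMSEQ_zero)
    then have "(\<lambda>k::nat. measure M U) \<longlonglongrightarrow> 0" using A by (simp add: measure_def)
    then have "measure M U = 0" by (simp add: LIMSEQ_const_iff)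
    then show False using U(2) by (simp add: emeasure_eq_measure)
  qed
  then obtain a b where "a \<noteq> b" "A a \<inter> A b \<noteq> {}"
    by (auto simp: disjoint_family_on_def)
  then obtain m n where "m < n" "A m \<inter> A n \<noteq> {}"
    by (metis inf_commute linorder_neqE_nat)
  then obtain z where "(f ^^ m) z \<in> U" "(f ^^ n) z \<in> U" by (auto simp: A_def)
  moreover have "(f ^^ n) z = (f ^^ (n - m)) ((f ^^ m) z)"
    using \<open>m < n\<close> by (metis add.commute comp_apply funpow_add le_add_diff_inverse less_imp_le)
  ultimately show ?thesis using that[of "(f ^^ m) z" "n - m"] \<open>m < n\<close> by simp
qed

text \<open>Turns the measure into a purely topological property of \<open>f\<close>. Full support
  gives every nonempty open set positive measure, and measurability of a continuous map need only be
  checked on the open sets, which generate the Borel sets.\<close>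

lemma full_support_recurrence:
  assumes "continuous_map (mtopology_of X) (mtopology_of X) f"
    and "borel_prob_measure X \<mu>" "invariant_measure X f \<mu>" "full_support X \<mu>"
    and "openin (mtopology_of X) U" "x \<in> U"
  obtains y n where "y \<in> U" "n > 0" "(f ^^ n) y \<in> U"
proof -
  interpret prob_space \<mu> using assms(2) by (simp add: borel_prob_measure_def)
  have sp: "space \<mu> = mspace X"
    and se: "sets \<mu> = sigma_sets (mspace X) {U. openin (mtopology_of X) U}"
    using assms(2) by (auto simp: borel_prob_measure_def)
  have op: "V \<in> sets \<mu>" if "openin (mtopology_of X) V" for V
    using that se by auto
  have "f \<in> measurable \<mu> \<mu>"
  proof (rule measurable_sigma_sets[OF se])
    fix V assume "V \<in> {U. openin (mtopology_of X) U}"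
    then have "openin (mtopology_of X) {x \<in> mspace X. f x \<in> V}"
      using openin_continuous_map_preimage[OF assms(1)] by auto
    moreover have "{x \<in> mspace X. f x \<in> V} = f -` V \<inter> space \<mu>" using sp by auto
    ultimately show "f -` V \<inter> space \<mu> \<in> sets \<mu>" using op by metis
  qed (use sp continuous_map_funspace[OF assms(1)] openin_subset in \<open>fastforce+\<close>)
  moreover have "x \<in> mspace X" using assms(5,6) openin_subset by fastforce
  then have "emeasure \<mu> U > 0"
    using assms(4-6) by (auto simp: full_support_def measure_support_def)
  ultimately show ?thesis
    using poincare_recurrence[of f U] that op[OF assms(5)] assms(3) sp
    unfolding invariant_measure_def by metis
qed

text \<open>The cyclic shift that closes up an orbit segment of length \<open>n\<close>. An
  injective self-map of a finite set is onto.\<close>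

lemma bij_betw_Suc_mod: "bij_betw (\<lambda>t. Suc t mod n) {..<n} {..<n}"
proof -
  have "inj_on (\<lambda>t. Suc t mod n) {..<n}"
    by (auto simp: inj_on_def mod_Suc split: if_splits)
  moreover have "(\<lambda>t. Suc t mod n) ` {..<n} \<subseteq> {..<n}" by (auto simp: image_subset_iff)
  ultimately show ?thesis by (simp add: bij_betw_def endo_inj_surj)
qed

text \<open>Around each point of a finite net a recurrent point is chosen, and its orbit segment is
  closed up at a return time. The indices are pairs of a net point and a time rather than points of
  \<open>X\<close>: segments may meet, and then a successor map on the visited points could fail to
  be well defined or injective.\<close>

lemma finite_pseudo_orbits:
  fixes X :: "'a metric"
  assumes "compact_metric X" and f: "f \<in> mspace X \<rightarrow> mspace X" and "\<epsilon> > 0"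
    and rec: "\<And>U x. \<lbrakk>openin (mtopology_of X) U; x \<in> U\<rbrakk> \<Longrightarrow> \<exists>y\<in>U. \<exists>n>0. (f ^^ n) y \<in> U"
  obtains S :: "('a \<times> nat) set" and r q where "finite S" "bij_betw r S S" "q \<in> S \<rightarrow> mspace X"
    "\<And>s. s \<in> S \<Longrightarrow> mdist X (q (r s)) (f (q s)) < \<epsilon>"
    "\<And>x. x \<in> mspace X \<Longrightarrow> \<exists>s\<in>S. mdist X (q s) x < \<epsilon>"
proof -
  interpret Metric_space "mspace X" "mdist X" by simp
  have "mtotally_bounded (mspace X)"
    using assms(1) compactin_imp_mtotally_bounded
    by (simp add: compact_metric_def compact_space_def mtopology_of_def)
  then obtain K where K: "finite K" "K \<subseteq> mspace X" "mspace X \<subseteq> (\<Union>x\<in>K. mball x (\<epsilon>/2))"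
    using \<open>\<epsilon> > 0\<close> unfolding mtotally_bounded_def by (meson half_gt_zero)
  have "\<forall>x\<in>K. \<exists>y n. y \<in> mball x (\<epsilon>/2) \<and> n > 0 \<and> (f ^^ n) y \<in> mball x (\<epsilon>/2)"
  proof
    fix x assume "x \<in> K"
    then have "x \<in> mball x (\<epsilon>/2)" using K(2) \<open>\<epsilon> > 0\<close> by auto
    moreover have "openin (mtopology_of X) (mball x (\<epsilon>/2))" by (simp add: mtopology_of_def)
    ultimately show "\<exists>y n. y \<in> mball x (\<epsilon>/2) \<and> n > 0 \<and> (f ^^ n) y \<in> mball x (\<epsilon>/2)"
      using rec by blast
  qed
  then obtain y n where yn: "\<And>x. x \<in> K \<Longrightarrow>
      y x \<in> mball x (\<epsilon>/2) \<and> n x > 0 \<and> (f ^^ n x) (y x) \<in> mball x (\<epsilon>/2)"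
    by metis
  define S where "S = Sigma K (\<lambda>x. {..<n x})"
  define r where "r = (\<lambda>(x, t). (x, Suc t mod n x))"
  define q where "q = (\<lambda>(x, t). (f ^^ t) (y x))"
  \<comment> \<open>This is why the balls have radius \<epsilon>/2. It bounds both the jump that
    closes a segment and the distance from a point to the nearest segment start.\<close>
  have close: "mdist X a b < \<epsilon>" if "a \<in> mball x (\<epsilon>/2)" "b \<in> mball x (\<epsilon>/2)" for a b x
    using that triangle[of a x b] commute[of a x] by auto
  have iter: "(f ^^ t) z \<in> mspace X" if "z \<in> mspace X" for t z
    using that f by (induction t) auto
  show ?thesis
  proof (rule that[of S r q])
    show "finite S" using K(1) by (auto simp: S_def)
    have "inj_on r S"
    proof (rule inj_onI)
      fix s s' assume "s \<in> S" "s' \<in> S" "r s = r s'"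
      then obtain x t t' where s: "s = (x, t)" "s' = (x, t')" "t \<in> {..<n x}" "t' \<in> {..<n x}"
        "Suc t mod n x = Suc t' mod n x"
        by (auto simp: S_def r_def)
      have "t = t'"
        by (rule inj_onD[OF bij_betw_imp_inj_on[OF bij_betw_Suc_mod] s(5,3,4)])
      then show "s = s'" using s by simp
    qed
    moreover have "r ` S \<subseteq> S" using yn by (auto simp: S_def r_def)
    ultimately show "bij_betw r S S" using \<open>finite S\<close> by (simp add: bij_betw_def endo_inj_surj)
    show "q \<in> S \<rightarrow> mspace X" using yn iter by (force simp: S_def q_def)
  next
    fix s assume "s \<in> S"
    then obtain x t where s: "s = (x, t)" "x \<in> K" "t < n x" by (auto simp: S_def)
    show "mdist X (q (r s)) (f (q s)) < \<epsilon>"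
    \<comment> \<open>Before the last time of a segment \<open>r\<close> follows \<open>f\<close>
      exactly. At the last time the shift returns to \<open>y x\<close>, which shares a ball with
      the true image \<open>(f ^^ n x) (y x)\<close>.\<close>
    proof (cases "Suc t < n x")
      case True
      moreover have "(f ^^ Suc t) (y x) \<in> mspace X" using yn[OF s(2)] iter by (metis in_mball)
      ultimately show ?thesis using s \<open>\<epsilon> > 0\<close> by (simp add: q_def r_def)
    next
      case False
      then have "Suc t = n x" using s by simp
      then have "q (r s) = y x" using s by (simp add: q_def r_def)
      moreover have "f (q s) = (f ^^ n x) (y x)"
        using s \<open>Suc t = n x\<close>[symmetric] by (simp add: q_def)
      ultimately show ?thesis using close yn[OF s(2)] by metis
    qed
  next
    fix z assume "z \<in> mspace X"
    then obtain x where "x \<in> K" "z \<in> mball x (\<epsilon>/2)" using K(3) by auto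
    \<comment> \<open>Time 0 is an admissible index since \<open>n x > 0\<close>, and it represents
      \<open>y x\<close>, which lies in the same ball as \<open>z\<close>.\<close>
    then have "(x, 0) \<in> S" "mdist X (q (x, 0)) z < \<epsilon>"
      using yn close by (auto simp: S_def q_def)
    then show "\<exists>s\<in>S. mdist X (q s) z < \<epsilon>" by blast
  qed
qed

text \<open>The approximating space must have type \<open>real metric\<close>. The finite index set
  is therefore relabelled by the reals 0, ..., \<open>card S - 1\<close>, and the permutation is
  conjugated by the relabelling.\<close>

lemma finite_pseudo_orbits_real:
  assumes "finite S" "bij_betw r S S" "q \<in> S \<rightarrow> mspace X"
    "\<And>s. s \<in> S \<Longrightarrow> mdist X (q (r s)) (f (q s)) < \<epsilon>"
    "\<And>x. x \<in> mspace X \<Longrightarrow> \<exists>s\<in>S. mdist X (q s) x < \<epsilon>"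
  obtains R :: "real set" and g p where "finite R" "bij_betw g R R" "p \<in> R \<rightarrow> mspace X"
    "\<And>s. s \<in> R \<Longrightarrow> mdist X (p (g s)) (f (p s)) < \<epsilon>"
    "\<And>x. x \<in> mspace X \<Longrightarrow> \<exists>s\<in>R. mdist X (p s) x < \<epsilon>"
proof -
  define R where "R = real ` {..<card S}"
  have "finite R" "card R = card S" by (auto simp: R_def card_image)
  then obtain h where h: "bij_betw h R S" using \<open>finite S\<close> finite_same_card_bij by blast
  define k where "k = inv_into R h"
  have k: "bij_betw k S R" using h by (simp add: k_def bij_betw_inv_into)
  have hk: "h (k s) = s" if "s \<in> S" for s
    using that h by (simp add: k_def bij_betw_inv_into_right)
  have hR: "h u \<in> S" if "u \<in> R" for u using that h by (rule bij_betw_apply[rotated])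
  have rS: "r s \<in> S" if "s \<in> S" for s using that assms(2) by (rule bij_betw_apply[rotated])
  show ?thesis
  proof
    show "finite R" by fact
    show "bij_betw (k \<circ> (r \<circ> h)) R R" using h assms(2) k by (blast intro: bij_betw_trans)
    show "q \<circ> h \<in> R \<rightarrow> mspace X" using assms(3) hR by auto
    show "mdist X ((q \<circ> h) ((k \<circ> (r \<circ> h)) u)) (f ((q \<circ> h) u)) < \<epsilon>" if "u \<in> R" for u
      using assms(4) hR[OF that] rS hk by simp
    show "\<exists>s\<in>R. mdist X ((q \<circ> h) s) x < \<epsilon>" if x: "x \<in> mspace X" for x
    proof -
      obtain s where "s \<in> S" "mdist X (q s) x < \<epsilon>" using assms(5)[OF x] by blast
      then show ?thesis using hk k by (intro bexI[of _ "k s"]) (auto dest: bij_betw_apply)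
    qed
  qed
qed

section \<open>Permutations of finite metric spaces\<close>

lemma finite_metric_discrete:
  assumes "finite (mspace Y)"
  shows "mtopology_of Y = discrete_topology (mspace Y)"
proof (rule finite_topspace_imp_discrete_topology)
  show "Hausdorff_space (mtopology_of Y)"
    by (simp add: Metric_space.Hausdorff_space_mtopology mtopology_of_def)
qed (use assms in auto)

lemma finite_compact_metric: "finite (mspace Y) \<Longrightarrow> compact_metric Y"
  by (simp add: compact_metric_def finite_metric_discrete compact_space_discrete_topology)

lemma finite_homeomorphism_of:
  assumes "finite (mspace Y)" "bij_betw g (mspace Y) (mspace Y)"
  shows "homeomorphism_of Y g"
  unfolding homeomorphism_of_def finite_metric_discrete[OF assms(1)]
  using assms(2) by (intro bijective_open_imp_homeomorphic_map)
    (auto simp: bij_betw_def open_map_into_discrete_topology)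

text \<open>Separation numbers lie between 1 and the number of points, whatever \<open>n\<close> and
  \<delta> are, so their logarithms divided by \<open>n\<close> tend to 0.\<close>

lemma finite_topological_entropy:
  assumes fin: "finite (mspace Y)" and ne: "mspace Y \<noteq> {}"
  shows "topological_entropy Y g = 0"
proof -
  have "limsup (\<lambda>n. ereal (1 / real n * ln (real (separation_number Y g n \<delta>)))) = 0" for \<delta>
  proof -
    have sep: "1 \<le> separation_number Y g n \<delta>" "separation_number Y g n \<delta> \<le> card (mspace Y)" for n
    proof -
      obtain y where "y \<in> mspace Y" using ne by blast
      \<comment> \<open>A singleton is separated vacuously, also for \<open>n = 0\<close>. It gives
        the lower bound 1 and shows that the supremum is over a nonempty family.\<close>
      then have sing: "separated_set Y g n \<delta> {y}" by (auto simp: separated_set_def)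
      have le: "card E \<le> card (mspace Y)" if "separated_set Y g n \<delta> E" for E
        using that fin by (auto simp: separated_set_def intro: card_mono)
      then have "bdd_above (card ` {E. separated_set Y g n \<delta> E})" by (intro bdd_aboveI2) auto
      then have "card {y} \<le> separation_number Y g n \<delta>"
        unfolding separation_number_def using sing by (intro cSUP_upper) auto
      then show "1 \<le> separation_number Y g n \<delta>" by simp
      show "separation_number Y g n \<delta> \<le> card (mspace Y)"
        unfolding separation_number_def using sing le by (intro cSUP_least) auto
    qed
    have "(\<lambda>n. 1 / real n * ln (real (separation_number Y g n \<delta>))) \<longlonglongrightarrow> 0"
    proof (rule real_tendsto_sandwich[where f = "\<lambda>_. 0"])
      show "(\<lambda>n. 1 / real n * ln (real (card (mspace Y)))) \<longlonglongrightarrow> 0"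
        by (intro tendsto_mult_left_zero lim_1_over_n)
      have "0 \<le> ln (real (separation_number Y g n \<delta>))" for n
        using sep(1)[of n] by (intro ln_ge_zero) linarith
      then show "\<forall>\<^sub>F n in sequentially. 0 \<le> 1 / real n * ln (real (separation_number Y g n \<delta>))"
        by simp
      have "ln (real (separation_number Y g n \<delta>)) \<le> ln (real (card (mspace Y)))" for n
        using sep[of n] by (intro ln_mono) auto
      then show "\<forall>\<^sub>F n in sequentially. 1 / real n * ln (real (separation_number Y g n \<delta>))
          \<le> 1 / real n * ln (real (card (mspace Y)))"
        by (intro always_eventually allI mult_left_mono) auto
    qed auto
    then have "(\<lambda>n. ereal (1 / real n * ln (real (separation_number Y g n \<delta>)))) \<longlonglongrightarrow> ereal 0"
      by (simp only: tendsto_ereal)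
    then have "limsup (\<lambda>n. ereal (1 / real n * ln (real (separation_number Y g n \<delta>)))) = ereal 0"
      by (intro lim_imp_Limsup) auto
    then show ?thesis by (simp add: zero_ereal_def)
  qed
  \<comment> \<open>The limit superior is 0 for every \<delta>, so the limit at 0 is that of a
    constant function.\<close>
  then show ?thesis by (simp add: topological_entropy_def tendsto_Lim)
qed

section \<open>Approximation\<close>

text \<open>The pullback along \<open>q\<close> is only a pseudometric, since \<open>q\<close> may
  identify indices; adding \<eta> off the diagonal separates them. The triangle inequality survives:
  if \<open>u\<close> and \<open>w\<close> differ, then \<open>v\<close> differs from at least one
  of them, so the right side carries \<eta> as well.\<close>

lemma Metric_space_pullback_add_const:
  assumes "q \<in> S \<rightarrow> mspace X" "\<eta> > 0"
  shows "Metric_space S (\<lambda>u v. if u = v then 0 else mdist X (q u) (q v) + \<eta>)"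
proof
  fix u v w assume *: "u \<in> S" "v \<in> S" "w \<in> S"
  have "mdist X (q u) (q w) \<le> mdist X (q u) (q v) + mdist X (q v) (q w)"
    using * assms(1) by (intro mdist_triangle) auto
  then show "(if u = w then 0 else mdist X (q u) (q w) + \<eta>)
      \<le> (if u = v then 0 else mdist X (q u) (q v) + \<eta>) + (if v = w then 0 else mdist X (q v) (q w) + \<eta>)"
    using assms(2) mdist_nonneg[of X "q u" "q v"] mdist_nonneg[of X "q v" "q w"]
    by auto
qed (use assms(2) mdist_nonneg[of X] in \<open>auto simp: mdist_commute add_nonneg_eq_0_iff
  intro: less_imp_le\<close>)

section \<open>Pointwise criteria for \<Delta>-isometries and bounds on the C^0-Gromov-Hausdorff
  distance\<close>

lemma hausdorff_distance_le:
  assumes "\<And>a. a \<in> A \<Longrightarrow> \<exists>b\<in>B. mdist X a b \<le> c" "\<And>b. b \<in> B \<Longrightarrow> \<exists>a\<in>A. mdist X a b \<le> c"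
  shows "hausdorff_distance X A B \<le> ennreal c"
  unfolding hausdorff_distance_def
  by (intro max.boundedI SUP_least) (use assms in \<open>meson INF_lower2 ennreal_leI\<close>)+

text \<open>Pointwise strict bounds give only non-strict bounds on suprema. A uniform bound
  \<open>c\<close> below \<Delta> restores the strict inequality that the definition
  requires.\<close>

lemma delta_isometryI:
  assumes "i \<in> mspace X \<rightarrow> mspace Y" "0 \<le> c" "c < \<Delta>"
    "\<And>y. y \<in> mspace Y \<Longrightarrow> \<exists>x\<in>mspace X. mdist Y (i x) y \<le> c"
    "\<And>x x'. \<lbrakk>x \<in> mspace X; x' \<in> mspace X\<rbrakk> \<Longrightarrow> \<bar>mdist Y (i x) (i x') - mdist X x x'\<bar> \<le> c"
  shows "delta_isometry \<Delta> X Y i"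
proof -
  have "hausdorff_distance Y (i ` mspace X) (mspace Y) \<le> ennreal c"
  proof (rule hausdorff_distance_le)
    \<comment> \<open>Points of the image already lie in \<open>Y\<close> and approximate
      themselves, so only the density of the image is a real condition.\<close>
    fix a assume "a \<in> i ` mspace X"
    then have "a \<in> mspace Y" using assms(1) by auto
    then show "\<exists>b\<in>mspace Y. mdist Y a b \<le> c" using assms(2) by (intro bexI[of _ a]) (simp_all add: mdist_zero[THEN iffD2])
  qed (use assms(4) in auto)
  moreover have "(SUP x\<in>mspace X. SUP x'\<in>mspace X. ennreal \<bar>mdist Y (i x) (i x') - mdist X x x'\<bar>)
      \<le> ennreal c"
    by (intro SUP_least ennreal_leI assms(5))
  moreover have "ennreal c < ennreal \<Delta>" using assms(2,3) by (simp add: ennreal_lessI)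
  ultimately show ?thesis using assms(1) unfolding delta_isometry_def
    by (auto intro: le_less_trans)
qed

text \<open>The slack between \<open>c\<close> and \<Delta> again makes the suprema strictly smaller
  than \<Delta>. Hence \<Delta> belongs to the set whose infimum is taken.\<close>

lemma GH0_distance_le:
  assumes "0 \<le> c" "c < \<Delta>"
    and "delta_isometry \<Delta> X Y i" "delta_isometry \<Delta> Y X j"
    and "\<And>x. x \<in> mspace X \<Longrightarrow> mdist Y (g (i x)) (i (f x)) \<le> c"
    and "\<And>y. y \<in> mspace Y \<Longrightarrow> mdist X (j (g y)) (f (j y)) \<le> c"
  shows "GH0_distance X f Y g \<le> ennreal \<Delta>"
proof -
  have "ennreal c < ennreal \<Delta>" using assms(1,2) by (simp add: ennreal_lessI)
  moreover have "uniform_distance X Y (g \<circ> i) (i \<circ> f) \<le> ennreal c"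
    "uniform_distance Y X (j \<circ> g) (f \<circ> j) \<le> ennreal c"
    unfolding uniform_distance_def using assms(5,6) by (auto intro!: SUP_least ennreal_leI)
  ultimately show ?thesis unfolding GH0_distance_def
    using assms(1-4) by (intro Inf_lower) (use le_less_trans in fastforce)
qed

lemma mdist_quadrilateral:
  assumes "a \<in> mspace X" "b \<in> mspace X" "a' \<in> mspace X" "b' \<in> mspace X"
    "mdist X a a' \<le> c" "mdist X b b' \<le> c"
  shows "\<bar>mdist X a b - mdist X a' b'\<bar> \<le> 2 * c"
  using assms mdist_triangle[of a X a' b] mdist_triangle[of a' X b' b]
    mdist_triangle[of a' X a b'] mdist_triangle[of a X b b'] mdist_commute[of X]
  by (smt (verit))

text \<open>The map \<open>q\<close> serves as the isometry from \<open>Y\<close> to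
  \<open>X\<close>. In the other direction, each point of \<open>X\<close> is sent to some index
  whose image under \<open>q\<close> is close to it; this choice need not be continuous.\<close>

lemma pseudo_orbits_GH0_distance:
  fixes q :: "'b \<Rightarrow> 'a" and Y :: "'b metric"
  assumes "\<epsilon> > 0" and f: "f \<in> mspace X \<rightarrow> mspace X" and q: "q \<in> mspace Y \<rightarrow> mspace X"
    and g: "g \<in> mspace Y \<rightarrow> mspace Y"
    and unif: "\<And>x x'. \<lbrakk>x \<in> mspace X; x' \<in> mspace X; mdist X x x' < \<epsilon>\<rbrakk> \<Longrightarrow> mdist X (f x) (f x') \<le> \<kappa>"
    and dist: "\<And>u v. \<lbrakk>u \<in> mspace Y; v \<in> mspace Y\<rbrakk> \<Longrightarrow>
      mdist X (q u) (q v) \<le> mdist Y u v \<and> mdist Y u v \<le> mdist X (q u) (q v) + \<epsilon>"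
    and orbit: "\<And>u. u \<in> mspace Y \<Longrightarrow> mdist X (q (g u)) (f (q u)) < \<epsilon>"
    and dense: "\<And>x. x \<in> mspace X \<Longrightarrow> \<exists>u\<in>mspace Y. mdist X (q u) x < \<epsilon>"
    and \<Delta>: "3 * \<epsilon> + \<kappa> < \<Delta>" "0 \<le> \<kappa>"
  shows "GH0_distance X f Y g \<le> ennreal \<Delta>"
proof -
  \<comment> \<open>The worst error is that of \<open>g (i x)\<close> against
    \<open>i (f x)\<close>: one \<epsilon> for a pseudo-orbit step, \<kappa> for applying
    \<open>f\<close> to two close points, one \<epsilon> for the choice of \<open>i (f x)\<close>,
    and one \<epsilon> for passing from distances in \<open>X\<close> to distances in
    \<open>Y\<close>. The distortion of \<open>i\<close> costs at most 3 \<epsilon>, and the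
    remaining errors less.\<close>
  define c where "c = 3 * \<epsilon> + \<kappa>"
  obtain i where i: "\<And>x. x \<in> mspace X \<Longrightarrow> i x \<in> mspace Y \<and> mdist X (q (i x)) x < \<epsilon>"
    using dense by metis
  have qX: "q u \<in> mspace X" if "u \<in> mspace Y" for u using q that by auto
  have fX: "f x \<in> mspace X" if "x \<in> mspace X" for x using f that by auto
  have gY: "g u \<in> mspace Y" if "u \<in> mspace Y" for u using g that by auto
  show ?thesis
  proof (rule GH0_distance_le)
    show "0 \<le> c" "c < \<Delta>" using \<Delta> \<open>\<epsilon> > 0\<close> by (auto simp: c_def)
    show "delta_isometry \<Delta> X Y i"
    proof (rule delta_isometryI)
      show "i \<in> mspace X \<rightarrow> mspace Y" using i by auto
      show "0 \<le> c" "c < \<Delta>" by fact+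
      fix u assume u: "u \<in> mspace Y"
      \<comment> \<open>The indices \<open>i (q u)\<close> and \<open>u\<close> may differ, but
        their images under \<open>q\<close> are \<epsilon>-close, and \<open>dist\<close> adds at
        most another \<epsilon>.\<close>
      then have "mdist Y (i (q u)) u \<le> 2 * \<epsilon>"
        using i[OF qX[OF u]] dist[of "i (q u)" u] by linarith
      then show "\<exists>x\<in>mspace X. mdist Y (i x) u \<le> c"
        using qX[OF u] \<Delta> \<open>\<epsilon> > 0\<close> by (intro bexI[of _ "q u"]) (auto simp: c_def)
    next
      fix x x' assume x: "x \<in> mspace X" "x' \<in> mspace X"
      then have "\<bar>mdist X (q (i x)) (q (i x')) - mdist X x x'\<bar> \<le> 2 * \<epsilon>"
        using i qX by (intro mdist_quadrilateral) (auto intro: less_imp_le)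
      then show "\<bar>mdist Y (i x) (i x') - mdist X x x'\<bar> \<le> c"
        using dist[of "i x" "i x'"] i x \<Delta> \<open>\<epsilon> > 0\<close> unfolding c_def by (smt (verit))
    qed
    show "delta_isometry \<Delta> Y X q"
    proof (rule delta_isometryI)
      show "0 \<le> c" "c < \<Delta>" by fact+
      show "\<exists>u\<in>mspace Y. mdist X (q u) x \<le> c" if "x \<in> mspace X" for x
        using dense[OF that] \<Delta> \<open>\<epsilon> > 0\<close> unfolding c_def by (smt (verit))
      show "\<bar>mdist X (q u) (q v) - mdist Y u v\<bar> \<le> c" if "u \<in> mspace Y" "v \<in> mspace Y" for u v
        using dist[OF that] \<Delta> \<open>\<epsilon> > 0\<close> unfolding c_def by linarith
    qed (rule q)
    show "mdist X (q (g u)) (f (q u)) \<le> c" if "u \<in> mspace Y" for u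
      using orbit[OF that] \<Delta> \<open>\<epsilon> > 0\<close> unfolding c_def by linarith
    show "mdist Y (g (i x)) (i (f x)) \<le> c" if x: "x \<in> mspace X" for x
    proof -
      have in_X: "q (g (i x)) \<in> mspace X" "f (q (i x)) \<in> mspace X" "f x \<in> mspace X"
        "q (i (f x)) \<in> mspace X"
        using i x qX fX gY by blast+
      \<comment> \<open>The comparison is made in \<open>X\<close>, along the path from
        \<open>q (g (i x))\<close> through \<open>f (q (i x))\<close> and \<open>f x\<close> to
        \<open>q (i (f x))\<close>.\<close>
      have "mdist X (q (g (i x))) (q (i (f x)))
          \<le> mdist X (q (g (i x))) (f (q (i x))) + mdist X (f (q (i x))) (f x)
            + mdist X (q (i (f x))) (f x)"
        using in_X mdist_triangle[of "q (g (i x))" X "f (q (i x))" "q (i (f x))"]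
          mdist_triangle[of "f (q (i x))" X "f x" "q (i (f x))"] mdist_commute[of X "f x"]
        by (smt (verit))
      moreover have "mdist X (q (g (i x))) (f (q (i x))) < \<epsilon>" using orbit i x by blast
      moreover have "mdist X (f (q (i x))) (f x) \<le> \<kappa>" using unif i x qX by blast
      moreover have "mdist X (q (i (f x))) (f x) < \<epsilon>" using i fX x by blast
      moreover have "mdist Y (g (i x)) (i (f x)) \<le> mdist X (q (g (i x))) (q (i (f x))) + \<epsilon>"
        using dist i x gY fX by blast
      ultimately show ?thesis unfolding c_def by linarith
    qed
  qed
qed

section \<open>Choice of the tolerances and construction of the approximating permutation\<close>

theorem theorem1p1:
  fixes X :: "'a metric" and f :: "'a \<Rightarrow> 'a"
  assumes "compact_metric X"
    and "homeomorphism_of X f"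
    and "\<exists>\<mu>. borel_prob_measure X \<mu> \<and> invariant_measure X f \<mu> \<and> full_support X \<mu>"
  shows "\<forall>\<delta>::real. \<delta> > 0 \<longrightarrow>
    (\<exists>(Y :: real metric) (g :: real \<Rightarrow> real).
       compact_metric Y \<and> homeomorphism_of Y g \<and>
       GH0_distance X f Y g < ennreal \<delta> \<and>
       topological_entropy Y g = 0)"
proof (intro allI impI)
  fix \<delta> :: real assume "\<delta> > 0"
  obtain \<mu> where \<mu>: "borel_prob_measure X \<mu>" "invariant_measure X f \<mu>" "full_support X \<mu>"
    using assms(3) by blast
  \<comment> \<open>A probability space is nonempty. By density of the pseudo-orbits the finite
    model is then nonempty too, as the entropy computation requires.\<close>
  have "mspace X \<noteq> {}" using \<mu>(1) prob_space.not_empty by (auto simp: borel_prob_measure_def)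
  have cont: "continuous_map (mtopology_of X) (mtopology_of X) f"
    using assms(2) by (simp add: homeomorphism_of_def homeomorphic_imp_continuous_map)
  then have fX: "f \<in> mspace X \<rightarrow> mspace X" using continuous_map_funspace by fastforce
  have "uniformly_continuous_map X X f"
    using assms(1) cont by (simp add: compact_metric_def continuous_imp_uniformly_continuous_map)
  then obtain \<rho> where "\<rho> > 0"
    and \<rho>: "\<And>x y. \<lbrakk>x \<in> mspace X; y \<in> mspace X; mdist X y x < \<rho>\<rbrakk> \<Longrightarrow> mdist X (f y) (f x) < \<delta> / 8"
    using \<open>\<delta> > 0\<close> unfolding uniformly_continuous_map_def by (elim conjE allE[of _ "\<delta> / 8"]) auto
  \<comment> \<open>The bound \<rho> makes uniform continuity apply to \<epsilon>-close points with
    error \<delta>/8. The bound \<delta>/16 keeps the total error 3 \<epsilon> + \<delta>/8 at most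
    5 \<delta>/16, below \<delta>/2.\<close>
  define \<epsilon> where "\<epsilon> = min \<rho> (\<delta> / 16)"
  have "\<epsilon> > 0" using \<open>\<rho> > 0\<close> \<open>\<delta> > 0\<close> by (simp add: \<epsilon>_def)
  have rec: "\<exists>y\<in>U. \<exists>n>0. (f ^^ n) y \<in> U" if "openin (mtopology_of X) U" "x \<in> U" for U x
    using full_support_recurrence[OF cont \<mu> that] by metis
  obtain S :: "('a \<times> nat) set" and r q where S: "finite S" "bij_betw r S S" "q \<in> S \<rightarrow> mspace X"
    "\<And>s. s \<in> S \<Longrightarrow> mdist X (q (r s)) (f (q s)) < \<epsilon>"
    "\<And>x. x \<in> mspace X \<Longrightarrow> \<exists>s\<in>S. mdist X (q s) x < \<epsilon>"
    using finite_pseudo_orbits[OF assms(1) fX \<open>\<epsilon> > 0\<close>] rec by blast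
  obtain R :: "real set" and g p where R: "finite R" "bij_betw g R R" "p \<in> R \<rightarrow> mspace X"
    and orbit: "\<And>s. s \<in> R \<Longrightarrow> mdist X (p (g s)) (f (p s)) < \<epsilon>"
    and dense: "\<And>x. x \<in> mspace X \<Longrightarrow> \<exists>s\<in>R. mdist X (p s) x < \<epsilon>"
    using finite_pseudo_orbits_real[of S r q X f \<epsilon>, OF S] by blast
  interpret Y: Metric_space R "\<lambda>u v. if u = v then 0 else mdist X (p u) (p v) + \<epsilon>"
    using R(3) \<open>\<epsilon> > 0\<close> by (rule Metric_space_pullback_add_const)
  define Y where "Y = metric (R, \<lambda>u v. if u = v then 0 else mdist X (p u) (p v) + \<epsilon>)"
  have Y: "mspace Y = R" "mdist Y = (\<lambda>u v. if u = v then 0 else mdist X (p u) (p v) + \<epsilon>)"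
    by (simp_all add: Y_def)
  have "R \<noteq> {}" using dense \<open>mspace X \<noteq> {}\<close> by blast
  \<comment> \<open>Aiming at \<delta>/2 turns the non-strict bound on the infimum into the strict
    inequality with \<delta>.\<close>
  have "GH0_distance X f Y g \<le> ennreal (\<delta> / 2)"
  proof (rule pseudo_orbits_GH0_distance[OF \<open>\<epsilon> > 0\<close> fX])
    show "mdist X (f x) (f x') \<le> \<delta> / 8"
      if "x \<in> mspace X" "x' \<in> mspace X" "mdist X x x' < \<epsilon>" for x x'
      using \<rho>[of x' x] that by (simp add: \<epsilon>_def)
    show "mdist X (p u) (p v) \<le> mdist Y u v \<and> mdist Y u v \<le> mdist X (p u) (p v) + \<epsilon>"
      if "u \<in> mspace Y" "v \<in> mspace Y" for u v
      using that R(3) \<open>\<epsilon> > 0\<close> by (auto simp: Y Pi_iff mdist_zero[THEN iffD2])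
    show "3 * \<epsilon> + \<delta> / 8 < \<delta> / 2" using \<open>\<delta> > 0\<close> unfolding \<epsilon>_def by linarith
  qed (use R orbit dense \<open>\<delta> > 0\<close> in \<open>auto simp: Y bij_betw_def\<close>)
  also have "\<dots> < ennreal \<delta>" using \<open>\<delta> > 0\<close> by (simp add: ennreal_lessI)
  finally show "\<exists>(Y :: real metric) g. compact_metric Y \<and> homeomorphism_of Y g \<and>
      GH0_distance X f Y g < ennreal \<delta> \<and> topological_entropy Y g = 0"
    using finite_compact_metric[of Y] finite_homeomorphism_of[of Y g]
      finite_topological_entropy[of Y g] R(1,2) \<open>R \<noteq> {}\<close> Y(1) by auto
qed

end
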